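(* For every integer $r\equiv 1\pmod 4$ with $r\ge 9$, the digraph $\mathcal C_4(r)$ has a $4$-layer balanced Hamilton starter $H$ whose translates $H, H+4, H+8,\ldots,H+4(r-1)$ form a Hamilton decomposition of $\mathcal C_4(r)$ (i.e. they are Hamilton cycles whose arc sets partition the arc set of $\mathcal C_4(r)$), and every one of these developed cycles has winding number $(r+1)/2$.
   Context: For $r\ge1$ let $[r]=\{1,\ldots,r\}$. For $q\ge 3$, $\mathcal C_q(r)$ denotes the directed Cayley digraph on $\mathbb Z_{qr}$ with arcs $x\to x+s$ for all $x\in\mathbb Z_{qr}$, $s\in[r]$. The arc $x\to x+s$ has tail $x$ and step $s$. A $q$-layer balanced Hamilton starter of $\mathcal C_q(r)$ is a directed Hamilton cycle $H$ of $\mathcal C_q(r)$ such that for every $(j,s)\in\mathbb Z_q\times[r]$ it contains exactly one arc of step $s$ whose tail is congruent to $j$ modulo $q$. For an integer $c$, $H+c$ is the image of $H$ under $x\mapsto x+c$. The winding number of a closed directed walk $H$ in $\mathcal C_q(r)$ is $\omega(H)=\frac1{qr}\sum_{e\in H}s(e)$, where $s(e)\in[r]$ is the step of $e$ as a positive integer and arcs are counted with multiplicity. *)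

theory Defs
  imports
    Complex_Main
    "HOL-Library.Disjoint_Sets"
    "HOL-Number_Theory.Cong"
    "Graph_Theory.Graph_Theory"
begin

text \<open>
  Elements of \<open>\<int>/qr\<close> are represented by their least non-negative residues, and the arc
  \<open>x \<rightarrow> x + s\<close> by the pair \<open>(x, s)\<close> of its tail and its step. The lemma
  \<open>digraph_cayley\<close> shows that different pairs have different end points, so no parallel
  arcs arise from this encoding.
\<close>

definition cayley :: "int \<Rightarrow> int \<Rightarrow> (int, int \<times> int) pre_digraph" where
  "cayley q r =
     \<lparr> verts = {0..<q * r}, arcs = {0..<q * r} \<times> {1..r},
       tail = fst, head = (\<lambda>(x, s). (x + s) mod (q * r)) \<rparr>"

lemma digraph_cayley:
  assumes "q \<ge> 3" "r \<ge> 1"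
  shows "digraph (cayley q r)"
proof -
  have "r * 1 < r * q"
    using assms by (intro mult_strict_left_mono) auto
  then have r_less: "r < q * r"
    by (simp add: mult.commute)
  have step_inj: "s = t"
    if "(x + s) mod (q * r) = (x + t) mod (q * r)" "0 \<le> s" "s \<le> r" "0 \<le> t" "t \<le> r"
    for x s t :: int
  proof -
    have "[x + s = x + t] (mod q * r)"
      using that(1) by (simp only: cong_def)
    then have "[s = t] (mod q * r)"
      by (simp only: cong_add_lcancel)
    then show "s = t"
      using that r_less by (intro cong_less_imp_eq_int[of s "q * r" t]) auto
  qed
  show ?thesis
  proof
    fix e assume "e \<in> arcs (cayley q r)"
    then obtain x s where e: "e = (x, s)" "0 \<le> x" "x < q * r" "1 \<le> s" "s \<le> r"
      by (auto simp: cayley_def)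
    show "tail (cayley q r) e \<in> verts (cayley q r)"
      using e by (simp add: cayley_def)
    show "head (cayley q r) e \<in> verts (cayley q r)"
      using e by (simp add: cayley_def)
    have "x mod (q * r) \<noteq> (x + s) mod (q * r)"
      using step_inj[of x 0 s] e by auto
    moreover have "x mod (q * r) = x"
      using e by (intro mod_pos_pos_trivial)
    ultimately show "tail (cayley q r) e \<noteq> head (cayley q r) e"
      using e by (simp add: cayley_def)
  next
    fix e1 e2
    assume *: "e1 \<in> arcs (cayley q r)" "e2 \<in> arcs (cayley q r)"
      and eq: "arc_to_ends (cayley q r) e1 = arc_to_ends (cayley q r) e2"
    obtain x s y t where e: "e1 = (x, s)" "e2 = (y, t)"
      by (metis surj_pair)
    have xy: "x = y"
      using eq by (simp add: e cayley_def arc_to_ends_def)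
    moreover have "(x + s) mod (q * r) = (x + t) mod (q * r)"
      using eq xy by (auto simp: e cayley_def arc_to_ends_def)
    moreover have "0 \<le> s" "s \<le> r" "0 \<le> t" "t \<le> r"
      using * by (simp_all add: e cayley_def)
    ultimately show "e1 = e2"
      using step_inj[of x s t] e by blast
  next
    show "finite (verts (cayley q r))" "finite (arcs (cayley q r))"
      by (simp_all add: cayley_def)
  qed
qed

definition hamilton_cycle :: "('a, 'b) pre_digraph \<Rightarrow> 'b awalk \<Rightarrow> bool" where
  "hamilton_cycle G H \<longleftrightarrow> pre_digraph.cycle G H \<and> tail G ` set H = verts G"

definition hamilton_decomposition ::
    "('a, 'b) pre_digraph \<Rightarrow> 'i set \<Rightarrow> ('i \<Rightarrow> 'b awalk) \<Rightarrow> bool" where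
  "hamilton_decomposition G I F \<longleftrightarrow>
     (\<forall>i\<in>I. hamilton_cycle G (F i)) \<and>
     disjoint_family_on (\<lambda>i. set (F i)) I \<and>
     (\<Union>i\<in>I. set (F i)) = arcs G"

definition balanced_hamilton_starter :: "int \<Rightarrow> int \<Rightarrow> (int \<times> int) awalk \<Rightarrow> bool" where
  "balanced_hamilton_starter q r H \<longleftrightarrow>
     hamilton_cycle (cayley q r) H \<and>
     (\<forall>j\<in>{0..<q}. \<forall>s\<in>{1..r}. \<exists>!e. e \<in> set H \<and> snd e = s \<and> [fst e = j] (mod q))"

definition translate :: "int \<Rightarrow> int \<Rightarrow> int \<Rightarrow> (int \<times> int) awalk \<Rightarrow> (int \<times> int) awalk" where
  "translate q r c H = map (\<lambda>(x, s). ((x + c) mod (q * r), s)) H"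

definition winding_number_cayley :: "int \<Rightarrow> int \<Rightarrow> (int \<times> int) awalk \<Rightarrow> real" where
  "winding_number_cayley q r H = real_of_int (\<Sum>e\<leftarrow>H. snd e) / real_of_int (q * r)"

end

theory Submission
  imports Defs
begin

text \<open>
  Write \<open>r = 4 k + 1\<close>. A step function that is periodic modulo \<open>2 r\<close> suffices: if
  \<open>x \<mapsto> x + \<sigma> x\<close> is a single cycle on \<open>\<int>/2r\<close> and each parity class uses every step of \<open>[r]\<close> once,
  then one turn of this cycle advances by \<open>r (r + 1)\<close>, an odd multiple of \<open>2 r\<close>, so the cycle lifts
  to a Hamilton cycle on \<open>\<int>/4r\<close>, and the lift is balanced because \<open>r\<close> is odd.

  To find \<open>\<sigma>\<close>, start from the zigzag \<open>0, -1, 1, -2, 2, \<dots>\<close> in \<open>\<int>/r\<close> that skips the residue \<open>k\<close>. Its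
  differences are all the nonzero residues, and \<open>k\<close> takes the step \<open>r\<close>. On \<open>\<int>/2r\<close> this gives
  three cycles: the pair \<open>k, k + r\<close> and two lifts of the zigzag. Exchanging the heads of two
  arcs in different cycles joins the cycles. Two such exchanges, of the arcs at \<open>k\<close> and \<open>2 k\<close>
  (steps \<open>r\<close> and \<open>1\<close>, replaced by \<open>k + 1\<close> and \<open>3 k + 1\<close>) and of suitable arcs with steps \<open>k + 1\<close> and
  \<open>3 k + 1\<close> (replaced by \<open>r\<close> and \<open>1\<close> in some order), compensate each other in every parity class.
\<close>

section \<open>Hamilton cycles as cyclic lists of arcs\<close>

lemma (in pre_digraph) cas_iff_heads:
  "p \<noteq> [] \<Longrightarrow> cas (tail G (hd p)) p v \<longleftrightarrow> map (head G) p = tl (map (tail G) p) @ [v]"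
proof (induction p)
  case (Cons e p)
  then show ?case by (cases p) auto
qed simp

lemma hamilton_cycleI:
  assumes "wf_digraph G" and "H \<noteq> []" and "set H \<subseteq> arcs G"
    and closed: "map (head G) H = rotate1 (map (tail G) H)"
    and "distinct (map (tail G) H)" and "tail G ` set H = verts G"
  shows "hamilton_cycle G H"
proof -
  interpret wf_digraph G by fact
  define u where "u = tail G (hd H)"
  have cas: "cas u H u"
    unfolding u_def using assms(2) closed
    by (subst cas_iff_heads) (auto simp: rotate1_hd_tl hd_map)
  have "u \<in> verts G"
    using assms(2,6) by (auto simp: u_def)
  then have "awalk u H u"
    using cas assms(3) by (simp add: awalk_def)
  \<comment> \<open>The vertices after the start are the heads, which by \<open>closed\<close> are
    the rotated tails.\<close>
  moreover have "distinct (tl (awalk_verts u H))"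
    using assms(2,5) cas closed by (simp add: awalk_verts_conv'[OF cas])
  ultimately show ?thesis
    using assms(2,6) by (auto simp: hamilton_cycle_def cycle_def)
qed

subsection \<open>Cycles of a map as lists\<close>

definition cyc :: "('a \<Rightarrow> 'a) \<Rightarrow> 'a list \<Rightarrow> bool" where
  "cyc f xs \<longleftrightarrow> distinct xs \<and> map f xs = rotate1 xs"

lemma cyc_cong:
  assumes "cyc f xs" "\<And>x. x \<in> set xs \<Longrightarrow> g x = f x"
  shows "cyc g xs"
proof -
  have "map g xs = map f xs" using assms(2) by simp
  then show ?thesis using assms(1) by (metis cyc_def)
qed

lemma cyc_rotate:
  assumes "cyc f xs"
  shows "cyc f (rotate n xs)"
proof -
  have "map f (rotate n xs) = rotate n (rotate1 xs)"
    using assms by (simp add: cyc_def rotate_map[symmetric])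
  also have "\<dots> = rotate1 (rotate n xs)"
    by (simp add: rotate1_rotate_swap)
  finally show ?thesis using assms by (simp add: cyc_def)
qed

lemma cyc_ends_with:
  assumes "cyc f xs" "a \<in> set xs"
  obtains us where "cyc f (us @ [a])" "set (us @ [a]) = set xs"
proof -
  from assms(2) obtain u v where xs: "xs = u @ a # v"
    by (meson split_list)
  then have "rotate (length (u @ [a])) xs = v @ u @ [a]"
    using rotate_append[of "u @ [a]" v] by simp
  then have "cyc f ((v @ u) @ [a])"
    using cyc_rotate[OF assms(1)] by (metis append.assoc)
  moreover have "set ((v @ u) @ [a]) = set xs"
    by (auto simp: xs)
  ultimately show ?thesis using that by blast
qed

lemma cyc_starts_with:
  assumes "cyc f xs" "a \<in> set xs"
  obtains us where "cyc f (a # us)" "set (a # us) = set xs"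
proof -
  obtain us where us: "cyc f (us @ [a])" "set (us @ [a]) = set xs"
    by (rule cyc_ends_with[OF assms])
  have "cyc f (a # us)"
    using cyc_rotate[OF us(1), of "length us"] by (simp add: rotate_append)
  moreover have "set (a # us) = set xs" using us(2) by auto
  ultimately show ?thesis using that by blast
qed

text \<open>After the exchange \<open>a\<close> leads to the start of the second cycle and
  \<open>b\<close> to the start of the first. With the cycles rotated to end in \<open>a\<close> and
  \<open>b\<close>, their concatenation closes up as one cycle.\<close>

lemma cyc_merge:
  assumes "cyc f xs" "cyc f ys" "set xs \<inter> set ys = {}" "a \<in> set xs" "b \<in> set ys"
  obtains zs where "cyc (f(a := f b, b := f a)) zs" "set zs = set xs \<union> set ys"
proof -
  obtain us where us: "cyc f (us @ [a])" "set (us @ [a]) = set xs"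
    by (rule cyc_ends_with[OF assms(1,4)])
  obtain vs where vs: "cyc f (vs @ [b])" "set (vs @ [b]) = set ys"
    by (rule cyc_ends_with[OF assms(2,5)])
  define g where "g = f(a := f b, b := f a)"
  have dist: "distinct ((us @ [a]) @ (vs @ [b]))"
    using us vs assms(3) unfolding cyc_def distinct_append by blast
  have "map g us = map f us" "map g vs = map f vs"
    using dist by (auto simp: g_def)
  moreover have "g a = f b" "g b = f a"
    using dist by (auto simp: g_def)
  moreover have "map f us @ [f a] = rotate1 (us @ [a])" "map f vs @ [f b] = rotate1 (vs @ [b])"
    using us(1) vs(1) by (simp_all add: cyc_def)
  ultimately have "map g ((us @ [a]) @ (vs @ [b])) = rotate1 ((us @ [a]) @ (vs @ [b]))"
    by (cases us; cases vs) auto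
  then have "cyc g ((us @ [a]) @ (vs @ [b]))"
    using dist by (simp add: cyc_def)
  moreover have "set ((us @ [a]) @ (vs @ [b])) = set xs \<union> set ys"
    using us(2) vs(2) by auto
  ultimately show ?thesis using that unfolding g_def by blast
qed

lemma rotate1_map_upt: "rotate1 (map g [0..<n]) = map (\<lambda>i. g (Suc i mod n)) [0..<n]"
  by (rule nth_equalityI) (simp_all add: nth_rotate1)

lemma cyc_map_upt:
  assumes "inj_on g {..<n}" "\<And>i. i < n \<Longrightarrow> f (g i) = g (Suc i mod n)"
  shows "cyc f (map g [0..<n])"
  using assms by (simp add: cyc_def distinct_map atLeast0LessThan rotate1_map_upt)

lemma cyc_nth_funpow:
  assumes "cyc f xs" "n < length xs"
  shows "(f ^^ n) (hd xs) = xs ! n"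
  using assms(2)
proof (induction n)
  case 0
  then show ?case by (simp add: hd_conv_nth)
next
  case (Suc n)
  then have "(f ^^ Suc n) (hd xs) = map f xs ! n"
    by simp
  also have "\<dots> = rotate1 xs ! n"
    using assms(1) by (simp add: cyc_def)
  also have "\<dots> = xs ! Suc n"
    using Suc.prems by (simp add: nth_rotate1)
  finally show ?case .
qed

lemma cyc_funpow_length:
  assumes "cyc f xs" "xs \<noteq> []"
  shows "(f ^^ length xs) (hd xs) = hd xs"
proof -
  obtain m where m: "length xs = Suc m"
    using assms(2) by (cases xs) auto
  then have "(f ^^ length xs) (hd xs) = map f xs ! m"
    using cyc_nth_funpow[OF assms(1), of m] by simp
  also have "\<dots> = rotate1 xs ! m"
    using assms(1) by (simp add: cyc_def)
  also have "\<dots> = hd xs"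
    using m assms(2) by (simp add: nth_rotate1 hd_conv_nth)
  finally show ?thesis .
qed

subsection \<open>Balanced starters\<close>

lemma cayley_simps [simp]:
  "verts (cayley q r) = {0..<q * r}" "arcs (cayley q r) = {0..<q * r} \<times> {1..r}"
  "tail (cayley q r) = fst" "head (cayley q r) = (\<lambda>e. (fst e + snd e) mod (q * r))"
  by (auto simp: cayley_def split: prod.split)

lemma hamilton_cycle_cayleyI:
  assumes "q \<ge> 3" "r \<ge> 1" and "set H \<subseteq> {0..<q * r} \<times> {1..r}"
    and "map (\<lambda>e. (fst e + snd e) mod (q * r)) H = rotate1 (map fst H)"
    and "distinct (map fst H)" and "fst ` set H = {0..<q * r}"
  shows "hamilton_cycle (cayley q r) H"
proof (rule hamilton_cycleI)
  show "wf_digraph (cayley q r)"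
    using digraph_cayley[OF assms(1,2)] by (simp add: digraph_def fin_digraph_def)
  have "0 < q * r" using assms(1,2) by simp
  then have "fst ` set H \<noteq> {}"
    unfolding assms(6) by simp
  then show "H \<noteq> []" by auto
qed (use assms in simp_all)

lemma bij_betw_translate_mod:
  fixes n c :: int
  assumes "n > 0"
  shows "bij_betw (\<lambda>x. (x + c) mod n) {0..<n} {0..<n}"
proof -
  have inj: "inj_on (\<lambda>x. (x + c) mod n) {0..<n}"
  proof (rule inj_onI)
    fix x y assume xy: "x \<in> {0..<n}" "y \<in> {0..<n}" "(x + c) mod n = (y + c) mod n"
    then have "[x = y] (mod n)"
      by (metis cong_def cong_add_rcancel)
    with xy show "x = y"
      by (auto simp: cong_def)
  qed
  moreover have "(\<lambda>x. (x + c) mod n) ` {0..<n} = {0..<n}"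
    using assms by (intro endo_inj_surj[OF _ _ inj]) auto
  ultimately show ?thesis by (simp add: bij_betw_def)
qed

text \<open>Translation by \<open>q * i\<close> keeps the step of an arc and the layer of its tail
  modulo \<open>q\<close>. The starter has one arc per layer and step, and the \<open>r\<close>
  translates move its tail over the \<open>r\<close> vertices of that layer, so every arc occurs
  exactly once.\<close>

lemma balanced_starter_decomposition:
  fixes q r :: int
  assumes "q \<ge> 3" "r \<ge> 1" and H: "set H \<subseteq> {0..<q * r} \<times> {1..r}"
    and closed: "map (\<lambda>e. (fst e + snd e) mod (q * r)) H = rotate1 (map fst H)"
    and dist: "distinct (map fst H)" and span: "fst ` set H = {0..<q * r}"
    and bal: "\<And>j s. j \<in> {0..<q} \<Longrightarrow> s \<in> {1..r} \<Longrightarrow>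
      \<exists>!e. e \<in> set H \<and> snd e = s \<and> [fst e = j] (mod q)"
  shows "hamilton_decomposition (cayley q r) {0..<r} (\<lambda>i. translate q r (q * i) H)"
proof -
  define N where "N = q * r"
  have N: "N > 0" using assms(1,2) by (simp add: N_def)
  have tr: "translate q r c H = map (\<lambda>e. ((fst e + c) mod N, snd e)) H" for c
    by (simp add: translate_def case_prod_beta N_def)
  have "hamilton_cycle (cayley q r) (translate q r c H)" for c
  proof (rule hamilton_cycle_cayleyI[OF assms(1,2)])
    have fsts: "map fst (translate q r c H) = map (\<lambda>x. (x + c) mod N) (map fst H)"
      by (simp add: tr)
    show "set (translate q r c H) \<subseteq> {0..<q * r} \<times> {1..r}"
      using H N by (auto simp: tr N_def)
    have "map (\<lambda>e. (fst e + snd e) mod N) (translate q r c H) =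
        map (\<lambda>x. (x + c) mod N) (map (\<lambda>e. (fst e + snd e) mod N) H)"
      by (auto simp: tr mod_simps ac_simps)
    also have "\<dots> = rotate1 (map fst (translate q r c H))"
      using closed by (simp add: fsts rotate1_map N_def del: map_map)
    finally show "map (\<lambda>e. (fst e + snd e) mod (q * r)) (translate q r c H) =
        rotate1 (map fst (translate q r c H))"
      by (simp add: N_def)
    have bij: "bij_betw (\<lambda>x. (x + c) mod N) {0..<N} {0..<N}"
      by (rule bij_betw_translate_mod[OF N])
    show "distinct (map fst (translate q r c H))"
      unfolding fsts using dist bij span
      by (subst distinct_map) (simp add: bij_betw_def N_def)
    have "fst ` set (translate q r c H) = (\<lambda>x. (x + c) mod N) ` fst ` set H"
      by (simp add: tr image_image)
    also have "\<dots> = {0..<q * r}"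
      using bij span by (simp add: bij_betw_def N_def)
    finally show "fst ` set (translate q r c H) = {0..<q * r}" .
  qed
  moreover have "disjoint_family_on (\<lambda>i. set (translate q r (q * i) H)) {0..<r}"
  proof (unfold disjoint_family_on_def, intro ballI impI)
    fix i i' assume i: "i \<in> {0..<r}" "i' \<in> {0..<r}" "i \<noteq> i'"
    show "set (translate q r (q * i) H) \<inter> set (translate q r (q * i') H) = {}"
    proof (rule ccontr)
      assume "set (translate q r (q * i) H) \<inter> set (translate q r (q * i') H) \<noteq> {}"
      then obtain e e' where e: "e \<in> set H" "e' \<in> set H" "snd e = snd e'"
        "(fst e + q * i) mod N = (fst e' + q * i') mod N"
        by (auto simp: tr)
      \<comment> \<open>Modulo \<open>q\<close> the shifts disappear, so both arcs have the same
        layer and step and balance identifies them.\<close>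
      have "((fst e + q * i) mod N) mod q = ((fst e' + q * i') mod N) mod q"
        using e(4) by simp
      then have "fst e mod q = fst e' mod q"
        by (simp add: N_def mod_mod_cancel)
      moreover have "snd e \<in> {1..r}" "fst e mod q \<in> {0..<q}"
        using e(1) H assms(1) by auto
      ultimately have "e = e'"
        using bal[of "fst e mod q" "snd e"] e unfolding cong_def
        by (metis mod_mod_trivial)
      then have "[q * i = q * i'] (mod q * r)"
        using e(4) by (simp add: cong_def[symmetric] N_def cong_add_lcancel)
      then have "q * r dvd q * (i - i')"
        by (simp add: cong_iff_dvd_diff right_diff_distrib)
      then have "r dvd i - i'"
        using assms(1) by (simp add: dvd_mult_cancel_left)
      then show False
        using i by (metis atLeastLessThan_iff cong_iff_dvd_diff cong_less_imp_eq_int)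
    qed
  qed
  moreover have "(\<Union>i\<in>{0..<r}. set (translate q r (q * i) H)) = arcs (cayley q r)"
  proof (intro equalityI subsetI)
    fix a assume "a \<in> (\<Union>i\<in>{0..<r}. set (translate q r (q * i) H))"
    then show "a \<in> arcs (cayley q r)"
      using H N by (auto simp: tr N_def)
  next
    fix a assume "a \<in> arcs (cayley q r)"
    then obtain x s where a: "a = (x, s)" "0 \<le> x" "x < N" "s \<in> {1..r}"
      by (auto simp: N_def)
    have "x mod q \<in> {0..<q}" using assms(1) by simp
    then obtain e where e: "e \<in> set H" "snd e = s" "[fst e = x mod q] (mod q)"
      using bal[OF _ a(4)] by blast
    then have "x mod q = fst e mod q"
      by (simp add: cong_def)
    then have "q dvd x - fst e"
      by (simp add: mod_eq_dvd_iff)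
    then obtain d where d: "x - fst e = q * d" ..
    \<comment> \<open>The arc must be shifted by \<open>q * d\<close>; reducing \<open>d\<close>
      modulo \<open>r\<close> brings the index into range and changes the shift only by a multiple
      of \<open>N\<close>.\<close>
    have qd: "q * (d mod r) = (q * d) mod N"
      unfolding N_def by (rule mult_mod_right)
    have "(fst e + q * (d mod r)) mod N = (fst e + q * d) mod N"
      unfolding qd by (rule mod_add_right_eq)
    also have "\<dots> = x" using a(2,3) d by (simp add: algebra_simps)
    finally have "a = (\<lambda>e. ((fst e + q * (d mod r)) mod N, snd e)) e"
      using e(2) a(1) by simp
    then have "a \<in> set (translate q r (q * (d mod r)) H)"
      unfolding tr set_map using e(1) by (rule image_eqI)
    moreover have "d mod r \<in> {0..<r}" using assms(2) by simp
    ultimately show "a \<in> (\<Union>i\<in>{0..<r}. set (translate q r (q * i) H))"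
      by blast
  qed
  ultimately show ?thesis
    by (simp add: hamilton_decomposition_def)
qed

section \<open>Lifting a cycle from the integers modulo 2r to those modulo 4r\<close>

lemma sum_int_atLeastAtMost_1: "2 * \<Sum>{1..r} = r * (r + 1)" if "r \<ge> 0" for r :: int
  using that
proof (induction r rule: int_ge_induct)
  case (step i)
  have "{1..i + 1} = insert (i + 1) {1..i}" using step.hyps by auto
  then show ?case using step.IH by (simp add: algebra_simps)
qed simp

lemma translate_snd: "map snd (translate q r c H) = map snd H"
  by (simp add: translate_def case_prod_beta)

text \<open>One turn advances by \<open>r * (r + 1)\<close>, which is 2r modulo 4r, so the second
  turn visits the other preimage of every vertex. Two turns advance by
  \<open>4 * r * (2 * k + 1)\<close>, whence the winding number \<open>2 * k + 1\<close>.\<close>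

lemma starter_from_cyc:
  fixes r :: int and \<sigma> :: "int \<Rightarrow> int"
  assumes r: "r \<ge> 1" "[r = 1] (mod 4)"
    and cyc: "cyc (\<lambda>x. (x + \<sigma> x) mod (2 * r)) zs" and zs: "set zs = {0..<2 * r}"
    and range: "\<And>x. x \<in> {0..<2 * r} \<Longrightarrow> \<sigma> x \<in> {1..r}"
    and inj: "inj_on (\<lambda>x. (x mod 2, \<sigma> x)) {0..<2 * r}"
  shows "\<exists>H. balanced_hamilton_starter 4 r H \<and>
    hamilton_decomposition (cayley 4 r) {0..<r} (\<lambda>i. translate 4 r (4 * i) H) \<and>
    (\<forall>i\<in>{0..<r}. winding_number_cayley 4 r (translate 4 r (4 * i) H) = (real_of_int r + 1) / 2)"
proof -
  define N L where "N = 2 * r" and "L = nat N"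
  have N: "N > 0" "even N" using r by (simp_all add: N_def)
  obtain k where k: "r = 4 * k + 1"
    using r(2) by (metis cong_iff_lin mult.commute add.commute cong_sym)
  define f where "f = (\<lambda>x. (x + \<sigma> x) mod N)"
  obtain ws where ws: "cyc f (0 # ws)" "set (0 # ws) = set zs"
    using cyc_starts_with[OF cyc, of 0] zs r(1) unfolding f_def N_def by auto
  define xs where "xs = 0 # ws"
  have xs: "cyc f xs" "set xs = {0..<N}" "hd xs = 0" "xs \<noteq> []"
    using ws zs by (simp_all add: xs_def N_def)
  then have dxs: "distinct xs" by (simp add: cyc_def)
  have len: "length xs = L"
    using distinct_card[OF dxs] by (simp add: xs(2) L_def)

  define s where "s = (\<lambda>x. \<sigma> (x mod N))"
  \<comment> \<open>The walk is kept in the integers, unreduced, so that \<open>W n\<close> is also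
    the sum of the first \<open>n\<close> steps.\<close>
  define W where "W = (\<lambda>n. ((\<lambda>x. x + s x) ^^ n) 0)"
  have W0: "W 0 = 0" and W_Suc: "W (Suc n) = W n + s (W n)" for n
    by (simp_all add: W_def)
  have W_mod: "W n mod N = (f ^^ n) 0" for n
  proof (induction n)
    case (Suc n)
    have "W (Suc n) mod N = (W n mod N + \<sigma> (W n mod N)) mod N"
      by (simp add: W_Suc s_def mod_add_left_eq)
    then show ?case using Suc by (simp add: f_def)
  qed (simp add: W0)
  have W_nth: "W n mod N = xs ! n" if "n < L" for n
    using cyc_nth_funpow[OF xs(1), of n] that by (simp add: W_mod len xs(3))
  have W_inj: "n = m" if "W n mod N = W m mod N" "n < L" "m < L" for n m
    using that dxs len by (simp add: W_nth nth_eq_iff_index_eq)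
  have W_per: "W (n + L) mod N = W n mod N" for n
    using cyc_funpow_length[OF xs(1,4)] by (simp add: W_mod funpow_add len xs(3))
  have W_sum: "W n = (\<Sum>i<n. s (W i))" for n
    by (induction n) (simp_all add: W0 W_Suc)
  have s_range: "s x \<in> {1..r}" for x
    using range[of "x mod N"] r(1) by (simp add: s_def N_def)

  \<comment> \<open>By counting, injectivity makes every pair of parity and step occur, which
    determines the sum of all steps.\<close>
  have "(\<lambda>x. (x mod 2, \<sigma> x)) ` {0..<N} = {0..<2} \<times> {1..r}"
  proof (rule card_subset_eq)
    show "(\<lambda>x. (x mod 2, \<sigma> x)) ` {0..<N} \<subseteq> {0..<2} \<times> {1..r}"
      using range by (auto simp: N_def)
    show "card ((\<lambda>x. (x mod 2, \<sigma> x)) ` {0..<N}) = card ({0..<2::int} \<times> {1..r})"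
      using inj r(1) by (simp add: card_image N_def card_cartesian_product nat_mult_distrib)
  qed auto
  then have "(\<Sum>x\<in>{0..<N}. \<sigma> x) = (\<Sum>p\<in>{0..<2::int} \<times> {1..r}. snd p)"
    using inj by (subst \<open>_ = {0..<2} \<times> {1..r}\<close>[symmetric], subst sum.reindex) (simp_all add: N_def)
  also have "\<dots> = (\<Sum>a\<in>{0..<2::int}. \<Sum>b\<in>{1..r}. b)"
    by (subst sum.cartesian_product) (simp add: case_prod_beta)
  also have "\<dots> = r * (r + 1)"
    using sum_int_atLeastAtMost_1[of r] r(1) by simp
  finally have sum_\<sigma>: "(\<Sum>x\<in>{0..<N}. \<sigma> x) = r * (r + 1)" .
  have "W L = (\<Sum>i<L. \<sigma> (xs ! i))"
    unfolding W_sum[of L] by (intro sum.cong) (simp_all add: s_def W_nth)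
  also have "\<dots> = sum_list (map \<sigma> xs)"
    by (simp add: sum_list_sum_nth len atLeast0LessThan)
  also have "\<dots> = r * (r + 1)"
    using sum_list_distinct_conv_sum_set[OF dxs, of \<sigma>] by (simp add: xs(2) sum_\<sigma>)
  finally have W_L: "W L = r * (r + 1)" .
  have W_shift: "W (n + L) = W n + r * (r + 1)" for n
  proof (induction n)
    case (Suc n)
    then show ?case using W_per[of n] by (simp add: W_Suc s_def)
  qed (simp add: W0 W_L)

  \<comment> \<open>Within one turn positions already differ modulo 2r. Equal positions modulo 2r in
    different turns differ by \<open>r * (r + 1)\<close>, not a multiple of 4r since r + 1 is 2
    modulo 4.\<close>
  have W_inj2: "n = m" if "W n mod (4 * r) = W m mod (4 * r)" "n \<le> m" "m < 2 * L" for n m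
  proof -
    have dvd: "4 * r dvd W n - W m"
      using that(1) by (simp add: mod_eq_dvd_iff)
    then have "N dvd W n - W m"
      by (auto simp: N_def elim: dvd_trans[rotated])
    then have eqN: "W n mod N = W m mod N"
      by (simp add: mod_eq_dvd_iff)
    consider "m < L" | "L \<le> n" | "n < L" "L \<le> m" by linarith
    then show ?thesis
    proof cases
      case 1
      then show ?thesis using W_inj[OF eqN] that(2) by simp
    next
      case 2
      then have "W (n - L) mod N = W (m - L) mod N"
        using eqN W_per[of "n - L"] W_per[of "m - L"] that(2) by simp
      then have "n - L = m - L"
        using that 2 by (intro W_inj) auto
      then show ?thesis using 2 that(2) by simp
    next
      case 3
      then have "W n mod N = W (m - L) mod N"
        using eqN W_per[of "m - L"] by simp
      then have "n = m - L"
        using that 3 by (intro W_inj) auto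
      then have "W m = W n + r * (r + 1)"
        using W_shift[of n] 3 by simp
      then have "4 * r dvd r * (r + 1)"
        using dvd by simp
      then have "r * 4 dvd r * (r + 1)" by (simp add: mult.commute)
      then have "4 dvd r + 1" using r(1) by (subst (asm) dvd_mult_cancel_left) simp
      then show ?thesis unfolding k by presburger
    qed
  qed
  define V where "V = (\<lambda>n. W n mod (4 * r))"
  have V_inj: "inj_on V {..<2 * L}"
  proof (rule linorder_inj_onI')
    fix n m assume nm: "m \<in> {..<2 * L}" "n < m"
    have "n = m" if "V n = V m"
      by (rule W_inj2) (use that nm in \<open>simp_all add: V_def\<close>)
    then show "V n \<noteq> V m" using nm(2) by blast
  qed
  have "W (2 * L) = 2 * (r * (r + 1))"
    using W_shift[of L] W_L by (simp add: mult_2[of L])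
  also have "\<dots> = 4 * r * (2 * k + 1)" by (simp add: k algebra_simps)
  finally have W_2L: "W (2 * L) = 4 * r * (2 * k + 1)" .
  then have V_2L: "V (2 * L) = V 0"
    by (simp add: V_def W0)
  have V_Suc: "V (Suc n) = (V n + s (W n)) mod (4 * r)" for n
    by (simp add: V_def W_Suc mod_add_left_eq)

  define H where "H = map (\<lambda>n. (V n, s (W n))) [0..<2 * L]"
  have fst_H: "map fst H = map V [0..<2 * L]"
    by (simp add: H_def)
  have set_H: "set H = (\<lambda>n. (V n, s (W n))) ` {..<2 * L}"
    by (simp add: H_def atLeast0LessThan)
  have sub: "set H \<subseteq> {0..<4 * r} \<times> {1..r}"
    using s_range r(1) by (auto simp: set_H V_def)
  have closed: "map (\<lambda>e. (fst e + snd e) mod (4 * r)) H = rotate1 (map fst H)"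
  proof -
    have "V (Suc n) = V (Suc n mod (2 * L))" if "n < 2 * L" for n
      using that V_2L by (cases "Suc n = 2 * L") simp_all
    then show ?thesis
      unfolding fst_H rotate1_map_upt by (simp add: H_def V_Suc[symmetric])
  qed
  have dist: "distinct (map fst H)"
    unfolding fst_H distinct_map using V_inj by (simp add: atLeast0LessThan)
  have span: "fst ` set H = {0..<4 * r}"
  proof -
    have "V ` {..<2 * L} = {0..<4 * r}"
    proof (rule card_subset_eq)
      show "card (V ` {..<2 * L}) = card {0..<4 * r}"
        using V_inj r(1) by (simp add: card_image L_def N_def nat_mult_distrib)
    qed (use r(1) in \<open>auto simp: V_def\<close>)
    then show ?thesis by (simp add: set_H image_image)
  qed

  \<comment> \<open>The residue modulo 4 fixes the parity, and parity and step fix the position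
    modulo 2r. A difference \<open>2 * r * t\<close> divisible by 4 forces \<open>t\<close> even as
    r is odd, so the positions agree modulo 4r.\<close>
  have layer: "n = m" if "n \<le> m" "m < 2 * L" "V n mod 4 = V m mod 4" "s (W n) = s (W m)" for n m
  proof -
    have V4: "V n mod 4 = W n mod 4" for n
      unfolding V_def by (rule mod_mod_cancel) simp
    have mod4: "W n mod 4 = W m mod 4"
      using that(3) by (simp only: V4)
    have WN: "(W n mod N) mod 2 = W n mod 2" for n
      using N(2) by (intro mod_mod_cancel)
    have "W n mod 2 = W m mod 2"
      using arg_cong[OF mod4, of "\<lambda>x. x mod 2"] by (simp add: mod_mod_cancel)
    then have "(W n mod N) mod 2 = (W m mod N) mod 2"
      by (simp only: WN)
    then have "W n mod N = W m mod N"
      using that(4) N(1) by (intro inj_onD[OF inj]) (auto simp: s_def N_def)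
    then obtain t where t: "W n - W m = 2 * r * t"
      unfolding N_def mod_eq_dvd_iff by blast
    moreover have "4 dvd W n - W m"
      using mod4 by (simp add: mod_eq_dvd_iff)
    ultimately have "2 * 2 dvd 2 * (r * t)" by (simp add: mult.assoc)
    then have "even (r * t)" by (subst (asm) dvd_mult_cancel_left) simp
    then have "even t" by (simp add: k)
    then obtain u where "t = 2 * u" ..
    then have "W n mod (4 * r) = W m mod (4 * r)"
      using t by (simp add: mod_eq_dvd_iff)
    then show ?thesis using W_inj2 that(1,2) by blast
  qed
  define g where "g = (\<lambda>n. (V n mod 4, s (W n)))"
  have g_inj: "inj_on g {..<2 * L}"
  proof (rule linorder_inj_onI')
    fix n m assume nm: "m \<in> {..<2 * L}" "n < m"
    have "n = m" if "g n = g m"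
      by (rule layer) (use that nm in \<open>simp_all add: g_def\<close>)
    then show "g n \<noteq> g m" using nm(2) by blast
  qed
  have g_surj: "g ` {..<2 * L} = {0..<4} \<times> {1..r}"
  proof (rule card_subset_eq)
    show "card (g ` {..<2 * L}) = card ({0..<4::int} \<times> {1..r})"
      using g_inj r(1) by (simp add: card_image card_cartesian_product L_def N_def nat_mult_distrib)
  qed (use s_range in \<open>auto simp: g_def\<close>)
  have bal: "\<exists>!e. e \<in> set H \<and> snd e = t \<and> [fst e = j] (mod 4)" if "j \<in> {0..<4}" "t \<in> {1..r}" for j t
  proof -
    have jm: "j mod 4 = j" using that(1) by simp
    from that have "(j, t) \<in> g ` {..<2 * L}" by (simp add: g_surj)
    then obtain n where n: "n < 2 * L" "g n = (j, t)" by auto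
    show ?thesis
    proof (rule ex1I)
      show "(V n, s (W n)) \<in> set H \<and> snd (V n, s (W n)) = t \<and> [fst (V n, s (W n)) = j] (mod 4)"
        using n jm by (auto simp: set_H g_def cong_def)
    next
      fix e assume e: "e \<in> set H \<and> snd e = t \<and> [fst e = j] (mod 4)"
      then obtain m where m: "m < 2 * L" "e = (V m, s (W m))" by (auto simp: set_H)
      then have "g m = g n"
        using e n jm by (simp add: g_def cong_def)
      then show "e = (V n, s (W n))"
        using g_inj m n(1) by (metis inj_onD lessThan_iff)
    qed
  qed

  have "balanced_hamilton_starter 4 r H"
    unfolding balanced_hamilton_starter_def
    using hamilton_cycle_cayleyI[OF _ r(1) sub closed dist span] bal by simp
  moreover have "hamilton_decomposition (cayley 4 r) {0..<r} (\<lambda>i. translate 4 r (4 * i) H)"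
    using bal by (intro balanced_starter_decomposition[OF _ r(1) sub closed dist span]) auto
  moreover have "winding_number_cayley 4 r (translate 4 r c H) = (real_of_int r + 1) / 2" for c
  proof -
    have "sum_list (map snd H) = W (2 * L)"
      by (simp add: H_def W_sum[of "2 * L"] o_def interv_sum_list_conv_sum_set_nat atLeast0LessThan)
    then have "winding_number_cayley 4 r (translate 4 r c H) =
        real_of_int (4 * r * (2 * k + 1)) / real_of_int (4 * r)"
      by (simp add: winding_number_cayley_def translate_snd W_2L)
    also have "\<dots> = real_of_int (2 * k + 1)"
      using r(1) by simp
    finally show ?thesis by (simp add: k)
  qed
  ultimately show ?thesis by blast
qed

subsection \<open>The zigzag modulo \<open>2 r\<close>\<close>

text \<open>The residue modulo \<open>2 r\<close> with parity \<open>e\<close> that reduces to \<open>y\<close> modulo the odd number \<open>r\<close>.\<close>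

definition crt_lift :: "int \<Rightarrow> int \<Rightarrow> int \<Rightarrow> int" where
  "crt_lift r e y = (if y mod 2 = e then y else y + r)"

lemma crt_lift:
  assumes "odd r" "0 \<le> y" "y < r" "e \<in> {0, 1}"
  shows "crt_lift r e y \<in> {0..<2 * r}" "crt_lift r e y mod 2 = e" "crt_lift r e y mod r = y"
proof -
  show "crt_lift r e y \<in> {0..<2 * r}" using assms by (auto simp: crt_lift_def)
  show "crt_lift r e y mod 2 = e"
    using assms(1,4) unfolding crt_lift_def by (cases "y mod 2 = e") (simp, simp, presburger)
  show "crt_lift r e y mod r = y" using assms by (simp add: crt_lift_def)
qed

lemma mod_double_eqI:
  fixes a b r :: int
  assumes "odd r" "a mod 2 = b mod 2" "a mod r = b mod r"
  shows "a mod (2 * r) = b mod (2 * r)"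
proof -
  have "2 dvd a - b" "r dvd a - b"
    using assms(2,3) by (simp_all only: mod_eq_dvd_iff)
  then have "2 * r dvd a - b"
    using assms(1) by (intro divides_mult) (simp_all add: coprime_commute)
  then show ?thesis by (simp add: mod_eq_dvd_iff)
qed

lemma eq_if_parity_residue:
  fixes x x' r :: int
  assumes "odd r" "x \<in> {0..<2 * r}" "x' \<in> {0..<2 * r}" "x mod 2 = x' mod 2" "x mod r = x' mod r"
  shows "x = x'"
  using mod_double_eqI[OF assms(1,4,5)] assms(2,3) by simp

text \<open>
  Modulo \<open>r = 4 k + 1\<close> the heads \<open>y + zigzag_step k y\<close> are, case by case, \<open>- 1 - y\<close>, \<open>k\<close>, \<open>- y\<close>, \<open>0\<close>,
  \<open>1 - y\<close>, \<open>k + 1\<close> and \<open>- y\<close>.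
\<close>

definition zigzag_step :: "int \<Rightarrow> int \<Rightarrow> int" where
  "zigzag_step k y =
     (if y < k then 4 * k - 2 * y
      else if y = k then 4 * k + 1
      else if y \<le> 2 * k then 4 * k + 1 - 2 * y
      else if y = 2 * k + 1 then 2 * k
      else if y \<le> 3 * k then 8 * k + 3 - 2 * y
      else if y = 3 * k + 1 then 2 * k + 1
      else 8 * k + 2 - 2 * y)"

lemma zigzag_step_range:
  assumes "0 \<le> y" "y \<le> 4 * k"
  shows "zigzag_step k y \<in> {1..4 * k + 1}"
  using assms by (auto simp: zigzag_step_def mod2_eq_if)

lemma zigzag_step_inj:
  assumes "0 \<le> y" "y \<le> 4 * k" "0 \<le> z" "z \<le> 4 * k" "zigzag_step k y = zigzag_step k z"
  shows "y = z"
proof -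
  \<comment> \<open>The steps \<open>4 * k + 1\<close>, \<open>2 * k\<close> and
    \<open>2 * k + 1\<close> occur only at the isolated residues. For the others, parity and
    comparison with \<open>2 * k\<close> reveal the linear branch.\<close>
  define inv_step where "inv_step s =
     (if s = 4 * k + 1 then k
      else if s = 2 * k then 2 * k + 1
      else if s = 2 * k + 1 then 3 * k + 1
      else if even s then (if s < 2 * k then 8 * k + 2 - s else 4 * k - s) div 2
      else (if s < 2 * k then 4 * k + 1 - s else 8 * k + 3 - s) div 2)" for s
  have "inv_step (zigzag_step k x) = x" if "0 \<le> x" "x \<le> 4 * k" for x
  proof -
    consider "x < k" | "x = k" | "k < x" "x \<le> 2 * k" | "x = 2 * k + 1"
      | "2 * k + 1 < x" "x \<le> 3 * k" | "x = 3 * k + 1" | "3 * k + 1 < x"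
      by linarith
    then show ?thesis
      using that by cases (simp_all add: zigzag_step_def inv_step_def)
  qed
  then show ?thesis using assms by metis
qed

definition zigzag_map :: "int \<Rightarrow> int \<Rightarrow> int" where
  "zigzag_map k x = (x + zigzag_step k (x mod (4 * k + 1))) mod (2 * (4 * k + 1))"

text \<open>Position \<open>m\<close> on a lift of the zigzag: odd positions carry -1, -2, ... and
  even ones 0, 1, ..., where the shift by one skips the residue \<open>k\<close>.\<close>

definition zigzag_vertex :: "int \<Rightarrow> int \<Rightarrow> int \<Rightarrow> int" where
  "zigzag_vertex k e m =
     (if odd m then crt_lift (4 * k + 1) e (4 * k - m div 2)
      else if m div 2 < k then crt_lift (4 * k + 1) e (m div 2)
      else crt_lift (4 * k + 1) (1 - e) (m div 2 + 1))"

text \<open>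
  All steps of the zigzag are even up to its passage over \<open>k\<close>, and odd from there until the last one.
  Hence the parity is constant along a lift except on the residues \<open>k + 1, \<dots>, 2 k\<close>.
\<close>

definition zigzag_orbit :: "int \<Rightarrow> int \<Rightarrow> int set" where
  "zigzag_orbit k e = {x \<in> {0..<2 * (4 * k + 1)}. x mod (4 * k + 1) \<noteq> k \<and>
     x mod 2 = (if k < x mod (4 * k + 1) \<and> x mod (4 * k + 1) \<le> 2 * k then 1 - e else e)}"

text \<open>By the Chinese remainder theorem an arc modulo 2r can be checked on residues modulo r
  and on parities separately; \<open>c\<close> counts the passages over r.\<close>

lemma zigzag_map_lift:
  assumes "k \<ge> 1" "0 \<le> y" "y \<le> 4 * k" "e \<in> {0, 1}" "0 \<le> z" "z \<le> 4 * k"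
    and "y + zigzag_step k y = z + c * (4 * k + 1)" "(e + zigzag_step k y) mod 2 = e'"
  shows "zigzag_map k (crt_lift (4 * k + 1) e y) = crt_lift (4 * k + 1) e' z"
proof (rule eq_if_parity_residue)
  define r where "r = 4 * k + 1"
  have r: "odd r" "r > 0" using assms(1) by (simp_all add: r_def)
  define x where "x = crt_lift r e y"
  have x: "x mod 2 = e" "x mod r = y"
    using crt_lift[of r y e] r assms by (auto simp: x_def r_def)
  have e': "e' \<in> {0, 1}" using assms(8) by auto
  note z = crt_lift[of r z e', OF r(1) assms(5) _ e']
  have zm: "zigzag_map k x = (x + zigzag_step k y) mod (2 * r)"
    using x(2) by (simp add: zigzag_map_def r_def)
  show "odd (4 * k + 1)" by simp
  show "zigzag_map k (crt_lift (4 * k + 1) e y) \<in> {0..<2 * (4 * k + 1)}"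
    using zm r(2) by (simp add: x_def r_def)
  show "crt_lift (4 * k + 1) e' z \<in> {0..<2 * (4 * k + 1)}"
    using z(1) assms(6) by (simp add: r_def)
  have "(x + zigzag_step k y) mod (2 * r) mod 2 = (x + zigzag_step k y) mod 2"
    by (rule mod_mod_cancel) simp
  also have "\<dots> = (e + zigzag_step k y) mod 2"
    unfolding x(1)[symmetric] by (simp add: mod_add_left_eq)
  finally show "zigzag_map k (crt_lift (4 * k + 1) e y) mod 2 = crt_lift (4 * k + 1) e' z mod 2"
    using zm z(2) assms(6,8) by (simp add: x_def r_def)
  have "(x + zigzag_step k y) mod (2 * r) mod r = (x + zigzag_step k y) mod r"
    by (rule mod_mod_cancel) simp
  also have "\<dots> = (y + zigzag_step k y) mod r"
    unfolding x(2)[symmetric] by (simp add: mod_add_left_eq)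
  also have "\<dots> = z mod r"
    unfolding assms(7) r_def[symmetric] by simp
  finally show "zigzag_map k (crt_lift (4 * k + 1) e y) mod (4 * k + 1) =
      crt_lift (4 * k + 1) e' z mod (4 * k + 1)"
    using zm z(3) assms(5,6) by (simp add: x_def r_def)
qed

text \<open>Even positions step up to a residue above \<open>2 * k\<close> without passing r
  (\<open>c = 0\<close>); odd positions pass r once (\<open>c = 1\<close>).\<close>

lemma zigzag_map_vertex:
  assumes "k \<ge> 2" "e \<in> {0, 1}" "0 \<le> m" "m < 4 * k"
  shows "zigzag_map k (zigzag_vertex k e m) = zigzag_vertex k e ((m + 1) mod (4 * k))"
proof (cases "even m")
  case True
  then obtain i where i: "m = 2 * i" ..
  have next_odd: "zigzag_vertex k e ((m + 1) mod (4 * k)) = crt_lift (4 * k + 1) e (4 * k - i)"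
    using assms by (simp add: i zigzag_vertex_def)
  show ?thesis
  proof (cases "i < k")
    case True
    then show ?thesis unfolding next_odd using assms i
      by (simp add: zigzag_vertex_def, intro zigzag_map_lift[where c = 0])
        (auto simp: zigzag_step_def mod2_eq_if)
  next
    case False
    then show ?thesis unfolding next_odd using assms i
      by (simp add: zigzag_vertex_def, intro zigzag_map_lift[where c = 0])
        (auto simp: zigzag_step_def mod2_eq_if)
  qed
next
  case False
  then obtain i where i: "m = 2 * i + 1" by (rule oddE)
  have v: "zigzag_vertex k e m = crt_lift (4 * k + 1) e (4 * k - i)"
    by (simp add: i zigzag_vertex_def)
  show ?thesis
  \<comment> \<open>The last position has residue \<open>2 * k + 1\<close>; its exceptional even
    step \<open>2 * k\<close> closes the cycle at 0 with parity \<open>e\<close>.\<close>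
  proof (cases "i = 2 * k - 1")
    case True
    then have "zigzag_vertex k e ((m + 1) mod (4 * k)) = crt_lift (4 * k + 1) e 0"
      using assms by (simp add: i zigzag_vertex_def)
    then show ?thesis unfolding v using assms True
      by (simp, intro zigzag_map_lift[where c = 1]) (auto simp: zigzag_step_def mod2_eq_if)
  next
    case False
    then have "(m + 1) mod (4 * k) = 2 * (i + 1)"
      using assms i by simp
    then have w: "zigzag_vertex k e ((m + 1) mod (4 * k)) =
        (if i + 1 < k then crt_lift (4 * k + 1) e (i + 1) else crt_lift (4 * k + 1) (1 - e) (i + 2))"
      by (simp add: zigzag_vertex_def add.commute)
    show ?thesis
    proof (cases "i + 1 < k")
      case True
      then show ?thesis unfolding v w using assms i False
        by (simp, intro zigzag_map_lift[where c = 1]) (auto simp: zigzag_step_def mod2_eq_if)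
    next
      case False
      then show ?thesis unfolding v w using assms i \<open>i \<noteq> 2 * k - 1\<close>
        by (simp, intro zigzag_map_lift[where c = 1]) (auto simp: zigzag_step_def mod2_eq_if)
    qed
  qed
qed

lemma zigzag_vertex_residue:
  assumes "k \<ge> 1" "e \<in> {0, 1}" "0 \<le> m" "m < 4 * k"
  shows "zigzag_vertex k e m \<in> {0..<2 * (4 * k + 1)}"
    and "zigzag_vertex k e m mod (4 * k + 1) =
      (if odd m then 4 * k - m div 2 else if m div 2 < k then m div 2 else m div 2 + 1)"
    and "zigzag_vertex k e m mod 2 = (if even m \<and> k \<le> m div 2 then 1 - e else e)"
proof -
  have e: "1 - e \<in> {0, 1}" using assms(2) by auto
  have "0 \<le> m div 2" "m div 2 < 2 * k" using assms(3,4) by auto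
  then show "zigzag_vertex k e m \<in> {0..<2 * (4 * k + 1)}"
    "zigzag_vertex k e m mod (4 * k + 1) =
      (if odd m then 4 * k - m div 2 else if m div 2 < k then m div 2 else m div 2 + 1)"
    "zigzag_vertex k e m mod 2 = (if even m \<and> k \<le> m div 2 then 1 - e else e)"
    using crt_lift[of "4 * k + 1" _ e, OF _ _ _ assms(2)] crt_lift[of "4 * k + 1" _ "1 - e", OF _ _ _ e]
    by (simp_all add: zigzag_vertex_def del: atLeastLessThan_iff)
qed

lemma zigzag_orbit_cyc:
  assumes "k \<ge> 2" "e \<in> {0, 1}"
  obtains xs where "cyc (zigzag_map k) xs" "set xs = zigzag_orbit k e"
proof -
  define g where "g n = zigzag_vertex k e (int n)" for n
  have "cyc (zigzag_map k) (map g [0..<nat (4 * k)])"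
  proof (rule cyc_map_upt)
    show "inj_on g {..<nat (4 * k)}"
    proof (rule inj_onI)
      fix n m assume nm: "n \<in> {..<nat (4 * k)}" "m \<in> {..<nat (4 * k)}" "g n = g m"
      define i j where "i = int n" and "j = int m"
      have ij: "0 \<le> i" "i < 4 * k" "0 \<le> j" "j < 4 * k" using nm by (auto simp: i_def j_def)
      have "zigzag_vertex k e i mod (4 * k + 1) = zigzag_vertex k e j mod (4 * k + 1)"
        using nm(3) by (simp add: g_def i_def j_def)
      then have "(if odd i then 4 * k - i div 2 else if i div 2 < k then i div 2 else i div 2 + 1) =
          (if odd j then 4 * k - j div 2 else if j div 2 < k then j div 2 else j div 2 + 1)"
        using assms ij by (simp only: zigzag_vertex_residue(2))
      \<comment> \<open>Residues at odd positions exceed \<open>2 * k\<close> and those at even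
        positions do not, so the residue determines the position.\<close>
      then have "i = j"
        using ij by (simp split: if_splits) presburger+
      then show "n = m" by (simp add: i_def j_def)
    qed
  next
    fix n assume n: "n < nat (4 * k)"
    have "int (Suc n mod nat (4 * k)) = (int n + 1) mod (4 * k)"
      using assms(1) by (simp add: zmod_int add.commute)
    then show "zigzag_map k (g n) = g (Suc n mod nat (4 * k))"
      unfolding g_def using zigzag_map_vertex[OF assms, of "int n"] n by simp
  qed
  moreover have "set (map g [0..<nat (4 * k)]) = zigzag_orbit k e"
  proof (intro equalityI subsetI)
    fix x assume "x \<in> set (map g [0..<nat (4 * k)])"
    then obtain n where n: "n < nat (4 * k)" "x = g n"
      by auto
    define m where "m = int n"
    have m: "0 \<le> m" "m < 4 * k" "x = zigzag_vertex k e m"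
      using n by (simp_all add: m_def g_def)
    note vr = zigzag_vertex_residue[OF _ assms(2) m(1,2)]
    have "x mod (4 * k + 1) \<noteq> k \<and>
        ((k < x mod (4 * k + 1) \<and> x mod (4 * k + 1) \<le> 2 * k) = (even m \<and> k \<le> m div 2))"
      using vr(2) m assms(1) by (auto simp: elim!: oddE)
    then show "x \<in> zigzag_orbit k e"
      using vr(1,3) m(3) assms(1) by (simp add: zigzag_orbit_def)
  next
    fix x assume x: "x \<in> zigzag_orbit k e"
    define y where "y = x mod (4 * k + 1)"
    have y: "0 \<le> y" "y \<le> 4 * k" "y \<noteq> k"
      using x assms(1) pos_mod_bound[of "4 * k + 1" x] by (auto simp: y_def zigzag_orbit_def)
    \<comment> \<open>This inverts the position formula: even positions below and above the gap at
      \<open>k\<close>, odd positions beyond \<open>2 * k\<close>.\<close>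
    define m where "m = (if y < k then 2 * y else if y \<le> 2 * k then 2 * (y - 1) else 2 * (4 * k - y) + 1)"
    have m: "0 \<le> m" "m < 4 * k" using y assms(1) by (auto simp: m_def)
    note vr = zigzag_vertex_residue[OF _ assms(2) m]
    have "x = zigzag_vertex k e m"
    proof (rule eq_if_parity_residue)
      show "x mod (4 * k + 1) = zigzag_vertex k e m mod (4 * k + 1)"
        using vr(2) y assms(1) by (simp add: y_def[symmetric] m_def)
      show "x mod 2 = zigzag_vertex k e m mod 2"
        using vr(3) y x assms(1) by (simp add: y_def[symmetric] m_def zigzag_orbit_def)
    qed (use vr(1) x assms(1) in \<open>simp_all add: zigzag_orbit_def\<close>)
    then have "x = g (nat m)" using m by (simp add: g_def)
    then show "x \<in> set (map g [0..<nat (4 * k)])" using m by auto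
  qed
  ultimately show ?thesis using that by blast
qed

section \<open>Joining the three cycles and trading the steps\<close>

lemma zigzag_orbits_joined:
  assumes "k \<ge> 2"
    and x3: "x3 \<in> zigzag_orbit k 1" and x4: "x4 \<in> zigzag_orbit k 0"
    and "x3 \<noteq> 2 * k"
  obtains zs where "set zs = {0..<2 * (4 * k + 1)}"
    "cyc ((zigzag_map k)(k := zigzag_map k (2 * k), 2 * k := zigzag_map k k,
       x3 := zigzag_map k x4, x4 := zigzag_map k x3)) zs"
proof -
  define r where "r = 4 * k + 1"
  define f where "f = zigzag_map k"
  define D where "D = zigzag_orbit k"
  define f1 where "f1 = f(k := f (2 * k), 2 * k := f k)"
  have k2: "k mod r = k" "2 * k mod r = 2 * k"
    using assms(1) by (simp_all add: r_def)
  then have kr: "(k + r) mod r = k" by simp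
  have "f k = k + r" "f (k + r) = k"
    using k2 kr assms(1) by (simp_all add: f_def zigzag_map_def zigzag_step_def r_def[symmetric])
      (simp_all add: r_def)
  then have cyc_P: "cyc f [k, k + r]"
    using assms(1) by (simp add: cyc_def r_def)
  have P: "{k, k + r} = {x \<in> {0..<2 * r}. x mod r = k}"
  proof (intro equalityI subsetI)
    fix x assume x: "x \<in> {x \<in> {0..<2 * r}. x mod r = k}"
    then show "x \<in> {k, k + r}"
      using mod_pos_pos_trivial[of "x - r" r] by (cases "x < r") auto
  qed (use k2 kr assms(1) in \<open>auto simp: r_def\<close>)
  obtain ys1 where ys1: "cyc f ys1" "set ys1 = D 1"
    using zigzag_orbit_cyc[of k 1] assms(1) unfolding f_def D_def by auto
  obtain ys0 where ys0: "cyc f ys0" "set ys0 = D 0"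
    using zigzag_orbit_cyc[of k 0] assms(1) unfolding f_def D_def by auto
  \<comment> \<open>The vertex \<open>2 * k\<close> is even and its residue is in the range of
    flipped parity, so it lies on the lift with \<open>e = 1\<close>; the first exchange thus joins
    the pair to that lift.\<close>
  have disj: "k \<notin> D 0" "2 * k \<notin> D 0" "2 * k \<in> D 1" "{k, k + r} \<inter> D 1 = {}"
    "({k, k + r} \<union> D 1) \<inter> D 0 = {}"
    unfolding P using k2 assms(1)
    by (auto simp: D_def zigzag_orbit_def r_def[symmetric]) (auto simp: r_def split: if_splits)
  have union: "({k, k + r} \<union> D 1) \<union> D 0 = {0..<2 * r}"
    unfolding P by (auto simp: D_def zigzag_orbit_def r_def[symmetric])
  have "set [k, k + r] \<inter> set ys1 = {}"
    using disj(4) by (simp only: list.set ys1(2))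
  then obtain zs1 where zs1: "cyc f1 zs1" "set zs1 = {k, k + r} \<union> D 1"
    using cyc_merge[OF cyc_P ys1(1), of k "2 * k"] disj(3) ys1(2) unfolding f1_def by auto
  have "cyc f1 ys0"
    using disj(1,2) ys0 by (intro cyc_cong[OF ys0(1)]) (auto simp: f1_def)
  then obtain zs where zs: "cyc (f1(x3 := f1 x4, x4 := f1 x3)) zs" "set zs = set zs1 \<union> set ys0"
    using cyc_merge[OF zs1(1), of ys0 x3 x4] disj(5) zs1(2) ys0(2) x3 x4
    unfolding D_def by auto
  \<comment> \<open>The first exchange alters only \<open>k\<close> and \<open>2 * k\<close>, so the
    second one still exchanges the original heads.\<close>
  have "f1 x4 = f x4" "f1 x3 = f x3"
    using x3 x4 disj assms(4) by (auto simp: f1_def D_def)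
  then show ?thesis
    using that[of zs] zs union zs1(2) ys0(2) by (simp add: f1_def f_def r_def)
qed

text \<open>
  In the zigzag the arcs with steps \<open>k + 1\<close> and \<open>3 k + 1\<close> are consecutive, the latter first iff \<open>k\<close> is
  odd. As these two steps add up to \<open>r + 1\<close>, exchanging the heads of suitable lifts of them
  turns the steps into \<open>r\<close> and \<open>1\<close>.
\<close>

lemma trade_arcs:
  fixes k :: int
  assumes "k \<ge> 2"
  defines "r \<equiv> 4 * k + 1"
  obtains x3 x4 where
    "x3 \<in> zigzag_orbit k 1" "x4 \<in> zigzag_orbit k 0"
    "zigzag_step k (x3 mod r) = k + 1" "zigzag_step k (x4 mod r) = 3 * k + 1"
    "x3 mod 2 = k mod 2" "x4 mod 2 = 0"
    "(x4 + (3 * k + 1)) mod (2 * r) = (x3 + (if odd k then r else 1)) mod (2 * r)"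
    "(x3 + (k + 1)) mod (2 * r) = (x4 + (if odd k then 1 else r)) mod (2 * r)"
proof -
  \<comment> \<open>The residues solve \<open>zigzag_step k y3 = k + 1\<close> and
    \<open>zigzag_step k y4 = 3 * k + 1\<close>; which branch applies depends on the parity of
    \<open>k\<close>. The parity \<open>e\<close> puts \<open>x3\<close> on the lift with
    \<open>e = 1\<close>.\<close>
  define e y3 y4 where "e = k mod 2"
    and "y3 = (if odd k then 4 * k + 1 - (k + 1) div 2 else 3 * k div 2)"
    and "y4 = (if odd k then (k - 1) div 2 else 5 * k div 2 + 1)"
  define x3 x4 where "x3 = crt_lift r e y3" and "x4 = crt_lift r 0 y4"
  have r: "odd r" by (simp add: r_def)
  have y: "0 \<le> y3" "y3 < r" "0 \<le> y4" "y4 < r" "e \<in> {0, 1}"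
    using assms(1) by (auto simp: y3_def y4_def r_def e_def)
  note l3 = crt_lift[OF r y(1,2,5), folded x3_def]
  note l4 = crt_lift[OF r y(3,4), of 0, folded x4_def, simplified]
  consider j where "k = 2 * j" "y3 = 3 * j" "y4 = 5 * j + 1"
    | j where "k = 2 * j + 1" "y3 = 7 * j + 4" "y4 = j"
    by (cases "even k"; elim evenE oddE) (auto simp: y3_def y4_def)
  then have steps: "zigzag_step k y3 = k + 1 \<and> zigzag_step k y4 = 3 * k + 1"
    and layers: "y3 \<noteq> k \<and> (k < y3 \<and> y3 \<le> 2 * k) = even k \<and> y4 \<noteq> k \<and> \<not> (k < y4 \<and> y4 \<le> 2 * k)"
    using assms(1) by (cases; simp add: zigzag_step_def)+
  from layers have orb: "x3 \<in> zigzag_orbit k 1" "x4 \<in> zigzag_orbit k 0"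
    using l3 l4 by (simp_all add: zigzag_orbit_def r_def[symmetric] e_def mod2_eq_if)
  have eq1: "(x4 + (3 * k + 1)) mod (2 * r) = (x3 + (if odd k then r else 1)) mod (2 * r)"
  proof (rule mod_double_eqI[OF r])
    have "(x4 + (3 * k + 1)) mod 2 = (0 + (3 * k + 1)) mod 2"
      using l4(2) by (metis mod_add_left_eq mod_0)
    also have "\<dots> = (e + (if odd k then r else 1)) mod 2"
      using r by (auto simp: e_def mod2_eq_if)
    also have "\<dots> = (x3 + (if odd k then r else 1)) mod 2"
      using l3(2) by (metis mod_add_left_eq)
    finally show "(x4 + (3 * k + 1)) mod 2 = (x3 + (if odd k then r else 1)) mod 2" .
    have "(x4 + (3 * k + 1)) mod r = (y4 + (3 * k + 1)) mod r"
      using l4(3) by (metis mod_add_left_eq)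
    also have "\<dots> = (y3 + (if odd k then r else 1)) mod r"
    proof (cases "odd k")
      case True
      then have "y4 + (3 * k + 1) = y3"
        by (auto simp: y3_def y4_def elim!: oddE)
      then show ?thesis using True by simp
    next
      case False
      then have *: "y4 + (3 * k + 1) = y3 + 1 + r"
        by (auto simp: y3_def y4_def r_def elim!: evenE)
      show ?thesis unfolding * using False by simp
    qed
    also have "\<dots> = (x3 + (if odd k then r else 1)) mod r"
      using l3(3) by (metis mod_add_left_eq)
    finally show "(x4 + (3 * k + 1)) mod r = (x3 + (if odd k then r else 1)) mod r" .
  qed
  have "2 * r dvd (x4 + (3 * k + 1)) - (x3 + (if odd k then r else 1))"
    using eq1 by (simp only: mod_eq_dvd_iff)
  \<comment> \<open>Old and new steps both sum to \<open>r + 1\<close>, so this difference is the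
    negative of the previous one.\<close>
  then have "2 * r dvd (x3 + (k + 1)) - (x4 + (if odd k then 1 else r))"
    by (subst dvd_minus_iff[symmetric]) (simp add: r_def algebra_simps split: if_splits)
  then have eq2: "(x3 + (k + 1)) mod (2 * r) = (x4 + (if odd k then 1 else r)) mod (2 * r)"
    by (simp only: mod_eq_dvd_iff)
  show ?thesis
    using that[OF orb _ _ _ _ eq1 eq2] l3(2,3) l4(2,3) steps by (simp add: e_def)
qed

lemma inj_id_fun_upd4:
  assumes "distinct [a, b, p, q]" "{c, d} = {a, b}"
  shows "inj (id(a := p, b := q, p := c, q := d))"
proof -
  have "(c = a \<and> d = b) \<or> (c = b \<and> d = a)"
    using assms(2) by (metis doubleton_eq_iff)
  then show ?thesis
    using assms(1) by (elim disjE) (auto simp: inj_def)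
qed

theorem theorem4p7:
  fixes r :: int
  assumes "[r = 1] (mod 4)" and "r \<ge> 9"
  shows "\<exists>H. balanced_hamilton_starter 4 r H \<and>
    hamilton_decomposition (cayley 4 r) {0..<r} (\<lambda>i. translate 4 r (4 * i) H) \<and>
    (\<forall>i\<in>{0..<r}. winding_number_cayley 4 r (translate 4 r (4 * i) H) = (real_of_int r + 1) / 2)"
proof -
  obtain k where k: "r = 4 * k + 1"
    using assms(1) by (metis cong_iff_lin mult.commute add.commute cong_sym)
  then have k2: "k \<ge> 2" using assms(2) by simp
  obtain x3 x4 where x3: "x3 \<in> zigzag_orbit k 1" and x4: "x4 \<in> zigzag_orbit k 0"
    and steps: "zigzag_step k (x3 mod r) = k + 1" "zigzag_step k (x4 mod r) = 3 * k + 1"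
    and par: "x3 mod 2 = k mod 2" "x4 mod 2 = 0"
    and heads: "(x4 + (3 * k + 1)) mod (2 * r) = (x3 + (if odd k then r else 1)) mod (2 * r)"
      "(x3 + (k + 1)) mod (2 * r) = (x4 + (if odd k then 1 else r)) mod (2 * r)"
    using trade_arcs[OF k2] unfolding k by blast
  define s where "s x = zigzag_step k (x mod r)" for x
  define \<sigma> where "\<sigma> = s(k := k + 1, 2 * k := 3 * k + 1,
    x3 := (if odd k then r else 1), x4 := (if odd k then 1 else r))"
  have s: "s k = r" "s (2 * k) = 1" "s x3 = k + 1" "s x4 = 3 * k + 1"
    using k2 steps by (simp_all add: s_def k zigzag_step_def)
  \<comment> \<open>Their original steps r, 1, \<open>k + 1\<close> and \<open>3 * k + 1\<close> are
    pairwise different.\<close>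
  have distinct: "distinct [k, 2 * k, x3, x4]"
    using s k2 k by auto
  have mem: "x3 \<in> {0..<2 * r}" "x4 \<in> {0..<2 * r}" "k \<in> {0..<2 * r}" "2 * k \<in> {0..<2 * r}"
    using x3 x4 k2 by (auto simp: zigzag_orbit_def k)
  have f: "zigzag_map k x = (x + s x) mod (2 * r)" for x
    by (simp add: zigzag_map_def s_def k)
  have s_range: "s x \<in> {1..r}" for x
    using zigzag_step_range[of "x mod r" k] k2 pos_mod_bound[of r x]
    by (simp add: s_def k)
  have s_inj: "x = y" if "x \<in> {0..<2 * r}" "y \<in> {0..<2 * r}" "x mod 2 = y mod 2" "s x = s y" for x y
  proof (rule eq_if_parity_residue[OF _ that(1-3)])
    show "odd r" by (simp add: k)
    show "x mod r = y mod r"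
      using that(4) zigzag_step_inj[of "x mod r" k "y mod r"] k2
        pos_mod_bound[of r x] pos_mod_bound[of r y] by (simp add: s_def k)
  qed
  obtain zs where zs: "set zs = {0..<2 * r}"
    "cyc ((zigzag_map k)(k := zigzag_map k (2 * k), 2 * k := zigzag_map k k,
       x3 := zigzag_map k x4, x4 := zigzag_map k x3)) zs"
    using zigzag_orbits_joined[OF k2 x3 x4] distinct unfolding k by auto
  show ?thesis
  proof (rule starter_from_cyc[of r \<sigma> zs])
    show "cyc (\<lambda>x. (x + \<sigma> x) mod (2 * r)) zs"
    proof (rule cyc_cong[OF zs(2)])
      fix x
      show "(x + \<sigma> x) mod (2 * r) = ((zigzag_map k)(k := zigzag_map k (2 * k), 2 * k := zigzag_map k k,
          x3 := zigzag_map k x4, x4 := zigzag_map k x3)) x"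
        using distinct heads s by (auto simp: \<sigma>_def f k)
    qed
    show "\<sigma> x \<in> {1..r}" for x
      using s_range[of x] k2 by (auto simp: \<sigma>_def k)
    show "inj_on (\<lambda>x. (x mod 2, \<sigma> x)) {0..<2 * r}"
    proof (rule inj_onI)
      fix x y
      assume xy: "x \<in> {0..<2 * r}" "y \<in> {0..<2 * r}" "(x mod 2, \<sigma> x) = (y mod 2, \<sigma> y)"
      \<comment> \<open>\<open>c\<close> and \<open>d\<close> are \<open>k\<close> and
        \<open>2 * k\<close>, ordered so that their original steps are the new steps of
        \<open>x3\<close> and \<open>x4\<close> and their parities match. For even \<open>k\<close>
        all four vertices are even, so the order may be swapped.\<close>
      define c d where "c = (if odd k then k else 2 * k)" and "d = (if odd k then 2 * k else k)"
      have cd: "c \<in> {0..<2 * r}" "d \<in> {0..<2 * r}" "c mod 2 = k mod 2" "d mod 2 = 0"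
        "s c = (if odd k then r else 1)" "s d = (if odd k then 1 else r)" "distinct [c, d, x3, x4]"
        using mem s distinct by (auto simp: c_def d_def mod2_eq_if)
      \<comment> \<open>\<open>\<pi> z\<close> is a vertex of the same parity whose original step is
        the new step of \<open>z\<close>. As \<pi> is injective, \<sigma> inherits injectivity on
        each parity class from \<open>s\<close>.\<close>
      define \<pi> where "\<pi> = id(k := x3, 2 * k := x4, x3 := c, x4 := d)"
      have \<pi>: "\<pi> z \<in> {0..<2 * r}" "\<pi> z mod 2 = z mod 2" "\<sigma> z = s (\<pi> z)"
        if "z \<in> {0..<2 * r}" for z
        using that mem(1,2) par s(3,4) distinct cd by (auto simp: \<pi>_def \<sigma>_def)
      have "\<pi> x = \<pi> y"
        by (rule s_inj) (use xy \<pi>(1)[OF xy(1)] \<pi>(1)[OF xy(2)] in \<open>simp_all add: \<pi>(2,3)\<close>)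
      moreover have "inj \<pi>"
        unfolding \<pi>_def by (rule inj_id_fun_upd4[OF distinct]) (auto simp: c_def d_def)
      ultimately show "x = y" by (simp add: inj_eq)
    qed
  qed (use assms zs(1) in auto)
qed

end
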